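(* Let $y:\mathbb{N}\to\mathbb{R}_{>0}$ be a monotone increasing function such that $y(n)\to\infty$ as $n\to\infty$ and $$y(n)<2^{-32}\log n\quad\text{for all sufficiently large } n.$$ Let $\mathcal{F}_y=\{n\in\mathbb{N}: p^+(n)\le y(n)\}$. Then the shifted set $\mathcal{G}_y:=\mathcal{F}_y+\{1\}=\{n+1: n\in\mathcal{F}_y\}$ is totally m-primitive.
   Context: $\mathbb{N}$ denotes the set of positive integers; $\log$ is the natural logarithm. For a positive integer $n$, $p^+(n)$ denotes the greatest prime factor of $n$ (with the convention $p^+(1)=1$). For a monotone increasing function $y$ on $\mathbb{N}$ with positive values, $n\in\mathbb{N}$ is called $y$-smooth if $p^+(n)\le y(n)$, and $\mathcal{F}_y$ is the set of all $y$-smooth positive integers. For sets $\mathcal{B},\mathcal{C}$ of positive integers, $\mathcal{B}\cdot\mathcal{C}=\{bc: b\in\mathcal{B},\ c\in\mathcal{C}\}$. An infinite set $\mathcal{A}\subset\mathbb{N}$ is m-reducible if there are sets $\mathcal{B},\mathcal{C}\subset\mathbb{N}$ with $|\mathcal{B}|\ge 2$, $|\mathcal{C}|\ge 2$ and $\mathcal{A}=\mathcal{B}\cdot\mathcal{C}$; if there are no such sets, $\mathcal{A}$ is m-primitive. Two sets $\mathcal{A},\mathcal{B}$ of non-negative integers are asymptotically equal, written $\mathcal{A}\sim\mathcal{B}$, if there is a number $K$ such that $\mathcal{A}\cap[K,+\infty)=\mathcal{B}\cap[K,+\infty)$. An infinite set $\mathcal{A}\subset\mathbb{N}$ is totally m-primitive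 if every $\mathcal{A}'\subset\mathbb{N}$ with $\mathcal{A}'\sim\mathcal{A}$ is m-primitive. *)

theory Defs
  imports
    Complex_Main
    "HOL-Computational_Algebra.Computational_Algebra"
    "HOL-Library.Set_Algebras"
begin

text \<open>
  Sets of positive integers are modelled as subsets of \<open>{1..}\<close> in type \<^typ>\<open>nat set\<close>.
  Products and shifts of sets are the elementwise operations of
  \<^theory>\<open>HOL-Library.Set_Algebras\<close>.
\<close>

text \<open>The value at \<open>0\<close> is irrelevant.\<close>

definition greatest_prime_factor :: "nat \<Rightarrow> nat" where
  "greatest_prime_factor n = (if n = 1 then 1 else Max (prime_factors n))"

definition smooth_numbers :: "(nat \<Rightarrow> real) \<Rightarrow> nat set" where
  "smooth_numbers y = {n. n \<ge> 1 \<and> real (greatest_prime_factor n) \<le> y n}"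

text \<open>
  The factors may be infinite, while \<^const>\<open>card\<close> is \<open>0\<close> on infinite sets; hence the
  disjunctions expressing that a set has at least two elements.
\<close>

definition m_reducible :: "nat set \<Rightarrow> bool" where
  "m_reducible A \<longleftrightarrow> infinite A \<and> A \<subseteq> {1..} \<and>
     (\<exists>B C. B \<subseteq> {1..} \<and> C \<subseteq> {1..} \<and>
            (infinite B \<or> card B \<ge> 2) \<and> (infinite C \<or> card C \<ge> 2) \<and>
            A = B * C)"

definition m_primitive :: "nat set \<Rightarrow> bool" where
  "m_primitive A \<longleftrightarrow> infinite A \<and> A \<subseteq> {1..} \<and> \<not> m_reducible A"

definition asymp_eq_sets :: "nat set \<Rightarrow> nat set \<Rightarrow> bool" where
  "asymp_eq_sets A B \<longleftrightarrow> (\<exists>K. A \<inter> {K..} = B \<inter> {K..})"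

definition totally_m_primitive :: "nat set \<Rightarrow> bool" where
  "totally_m_primitive A \<longleftrightarrow> infinite A \<and> A \<subseteq> {1..} \<and>
     (\<forall>A'. A' \<subseteq> {1..} \<and> asymp_eq_sets A' A \<longrightarrow> m_primitive A')"

end

theory Submission
  imports Defs "HOL-Real_Asymp.Real_Asymp"
begin

text \<open>
  Suppose that a set \<open>A\<close>, equal to the shifted smooth numbers from some point on, is a product
  \<open>B * C\<close>, and fix \<open>b1 < b2\<close> in \<open>B\<close> and \<open>c1 < c2\<close> in \<open>C\<close>. For every large \<open>c \<in> C\<close> both
  \<open>b1 * c - 1\<close> and \<open>b2 * c - 1\<close> are smooth, so \<open>C\<close> is thin, and by symmetry \<open>B\<close> is thin as well.
  But the products \<open>b * c\<close> up to a bound have to account for all shifted smooth numbers up to that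
  bound, and there are more of these than pairs \<open>(b, c)\<close>.

  \<^emph>\<open>Thinness.\<close> This is an S-unit equation, and \<open>card_smooth_pairs_dyadic_le\<close> replaces the deep
  bounds for the number of its solutions by an elementary gap principle: if \<open>S\<close> is a set of \<open>R\<close>
  primes, each interval \<open>{W..<2 * W}\<close> with \<open>W\<close> large contains at most \<open>32 ^ R\<close> numbers \<open>c\<close> for which
  \<open>b1 * c - 1\<close> and \<open>b2 * c - 1\<close> are composed of primes in \<open>S\<close>. Indeed a prime power dividing
  \<open>b1 * c - 1\<close> and \<open>b1 * c' - 1\<close> divides \<open>c' - c\<close>, and likewise for \<open>b2\<close>. The least common multiple
  \<open>D\<close> of the two numbers attached to \<open>c\<close> has size about \<open>W\<^sup>2\<close>. If the exponents of the primes in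
  \<open>D\<close> and in its analogue \<open>D'\<close> for \<open>c'\<close> agree up to a suitable rounding, then \<open>gcd D D'\<close> is at
  least \<open>W\<close>, yet it divides \<open>c' - c\<close>, which is less than \<open>W\<close>. There are only \<open>32 ^ R\<close> rounded
  exponent patterns. As just an upper bound up to a fixed height is required, summing over the
  dyadic intervals costs only one logarithm.

  \<^emph>\<open>Abundance.\<close> Let \<open>S\<close> be the set of the \<open>r\<close> primes up to \<open>y X\<close>. The products of powers of the
  primes of \<open>S\<close> with all exponents between \<open>m + 1\<close> and \<open>2 * m\<close>, where \<open>m\<close> is about
  \<open>ln X / ln (\<Prod>S)\<close>, are \<open>m ^ r\<close> smooth numbers between \<open>X\<close> and \<open>X\<^sup>2\<close>
  (\<open>power_card_le_card_smooth\<close>). The classical bound \<open>4 ^ n\<close> for the product of the primes up to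
  \<open>n\<close> and the hypothesis on \<open>y\<close> give \<open>m \<ge> 2 ^ 31\<close>.

  \<^emph>\<open>Comparison.\<close> Put \<open>X = 2 ^ a\<close>. The thinness estimate up to \<open>X\<^sup>2\<close> involves the number \<open>R\<close> of primes
  up to \<open>y (X\<^sup>2 * 2 ^ k)\<close> for a constant \<open>k\<close>. Since the number of primes up to \<open>y (2 ^ a)\<close> grows at
  most linearly in \<open>a\<close>, there are arbitrarily large \<open>a\<close> with \<open>R \<le> 3 * r\<close> (\<open>exists_slow_doubling\<close>).
  For such \<open>a\<close> the number of pairs is at most
  \<open>(3 * a * 32 ^ R)\<^sup>2 \<le> 9 * a\<^sup>2 * 2 ^ (30 * r)\<close>, which is less than \<open>m ^ r\<close>: when \<open>2 ^ r > 9 * a\<^sup>2\<close>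
  because \<open>m \<ge> 2 ^ 31\<close>, and otherwise because then \<open>r\<close> is at most logarithmic in \<open>a\<close>, so that \<open>m\<close> is
  much larger (\<open>eventually_exponent_bound\<close>).
\<close>

section \<open>Primes and prime factorizations\<close>

lemma prod_primes_dvd:
  fixes n :: nat
  assumes "finite S" "\<And>p. p \<in> S \<Longrightarrow> prime p" "\<And>p. p \<in> S \<Longrightarrow> p dvd n"
  shows "\<Prod>S dvd n"
proof (cases "n = 0")
  case False
  have "\<Prod>S = (\<Prod>p\<in>S. p ^ 1)" by simp
  also have "\<dots> dvd n"
  proof (rule multiplicity_le_imp_dvd)
    show "(\<Prod>p\<in>S. p ^ 1) \<noteq> 0"
      using assms by (auto dest: prime_gt_0_nat)
    fix p :: nat assume p: "prime p"
    show "multiplicity p (\<Prod>p\<in>S. p ^ 1) \<le> multiplicity p n"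
      using assms False p
      by (auto simp: multiplicity_prod_prime_powers[of S p "\<lambda>_. 1", simplified] prime_multiplicity_gt_zero_iff Suc_le_eq)
  qed
  finally show ?thesis .
qed simp

text \<open>
  Erdos' argument: for odd \<open>n = 2 * k + 1\<close> the primes in \<open>{k + 2..n}\<close> all divide
  \<open>n choose k\<close>, which is at most \<open>4 ^ k\<close> since it occurs twice in row \<open>n\<close> of Pascal's triangle.
\<close>

lemma primorial_le_four_power: "\<Prod>{p. prime p \<and> p \<le> n} \<le> 4 ^ (n::nat)"
proof (induction n rule: less_induct)
  case (less n)
  consider "n \<le> 1" | "n = 2" | "n > 2" "even n" | "n > 2" "odd n" by linarith
  then show ?case
  proof cases
    case 1
    then have "{p. prime p \<and> p \<le> n} = {}" by (auto dest: prime_ge_2_nat)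
    then show ?thesis by (simp only: prod.empty) simp
  next
    case 2
    then have "{p. prime p \<and> p \<le> n} = {2}"
      using le_antisym[OF _ prime_ge_2_nat] by auto
    then show ?thesis using 2 by (simp only: prod.insert) simp
  next
    case 3
    then have "\<not> prime n" using prime_odd_nat by blast
    then have "p \<le> n \<longleftrightarrow> p \<le> n - 1" if "prime p" for p
      using that by (cases "p = n") auto
    then have "{p. prime p \<and> p \<le> n} = {p. prime p \<and> p \<le> n - 1}" by blast
    then have "\<Prod>{p. prime p \<and> p \<le> n} \<le> 4 ^ (n - 1)"
      using less.IH[of "n - 1"] 3 by simp
    also have "\<dots> \<le> 4 ^ n" by (intro power_increasing) auto
    finally show ?thesis .
  next
    case 4
    then obtain k where n: "n = 2 * k + 1" by (elim oddE)
    with 4 have k: "k \<ge> 1" by simp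
    let ?S = "{p. prime p \<and> k + 1 < p \<and> p \<le> n}"
    have "\<Prod>?S dvd (n choose k)"
    proof (rule prod_primes_dvd)
      fix p assume p: "p \<in> ?S"
      have eq: "fact k * fact (k + 1) * (n choose k) = (fact n :: nat)"
        using binomial_fact_lemma[of k n] n by simp
      have "p dvd fact n" using p by (auto simp: prime_dvd_fact_iff)
      moreover have "\<not> p dvd fact k" "\<not> p dvd fact (k + 1)"
        using p by (auto simp: prime_dvd_fact_iff simp del: fact_Suc)
      ultimately show "p dvd (n choose k)"
        using p unfolding eq[symmetric] by (auto simp: prime_dvd_mult_iff simp del: fact_Suc)
    qed auto
    then have "\<Prod>?S \<le> (n choose k)" by (intro dvd_imp_le) (auto simp: n)
    also have "(n choose k) \<le> (\<Sum>i\<le>k. (2 * k + 1) choose i)"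
      unfolding n by (rule member_le_sum) auto
    also have "\<dots> = 4 ^ k" by (subst binomial_r_part_sum) (simp add: power_mult)
    finally have "\<Prod>?S \<le> 4 ^ k" .
    moreover have "\<Prod>{p. prime p \<and> p \<le> n} = \<Prod>{p. prime p \<and> p \<le> k + 1} * \<Prod>?S"
      by (subst prod.union_disjoint[symmetric]) (auto intro!: prod.cong simp: n)
    moreover have "\<Prod>{p. prime p \<and> p \<le> k + 1} \<le> 4 ^ (k + 1)"
      using k by (intro less.IH) (simp add: n)
    ultimately have "\<Prod>{p. prime p \<and> p \<le> n} \<le> 4 ^ (k + 1) * 4 ^ k"
      by (simp only: mult_le_mono)
    also have "\<dots> = 4 ^ n" unfolding n by (simp add: power_add[symmetric] mult_2)
    finally show ?thesis .
  qed
qed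

lemma ln_eq_sum_multiplicity:
  fixes n :: nat
  assumes "n > 0" "finite S" "\<And>p. p \<in> S \<Longrightarrow> prime p" "prime_factors n \<subseteq> S"
  shows "ln (real n) = (\<Sum>p\<in>S. real (multiplicity p n) * ln (real p))"
proof -
  have "real n = real (\<Prod>p\<in>prime_factors n. p ^ multiplicity p n)"
    using prime_factorization_nat[of n] assms(1) by simp
  also have "\<dots> = (\<Prod>p\<in>prime_factors n. real p ^ multiplicity p n)" by simp
  also have "ln \<dots> = (\<Sum>p\<in>prime_factors n. ln (real p ^ multiplicity p n))"
    by (rule ln_prod) (auto simp: prime_factors_gt_0_nat)
  also have "\<dots> = (\<Sum>p\<in>prime_factors n. real (multiplicity p n) * ln (real p))"
    by (intro sum.cong) (auto simp: ln_realpow prime_factors_gt_0_nat)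
  also have "\<dots> = (\<Sum>p\<in>S. real (multiplicity p n) * ln (real p))"
  proof (rule sum.mono_neutral_left)
    show "\<forall>i\<in>S - prime_factors n. real (multiplicity i n) * ln (real i) = 0"
    proof
      fix p assume "p \<in> S - prime_factors n"
      then have "\<not> p dvd n" using assms by (auto simp: prime_factors_dvd)
      then show "real (multiplicity p n) * ln (real p) = 0"
        by (simp add: not_dvd_imp_multiplicity_0)
    qed
  qed (use assms in auto)
  finally show ?thesis .
qed

section \<open>Counting pairs of smooth numbers by a gap principle\<close>

text \<open>
  In the application \<open>fst (f p)\<close> is a rounded exponent of the prime \<open>p\<close> and \<open>snd (f p)\<close> a label. The
  bound is Rankin's trick: every pattern counted has weight \<open>(1 / 2) ^ (\<Sum>p\<in>S. fst (f p))\<close> at least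
  \<open>(1 / 2) ^ k\<close>, while the weights of all patterns sum to a product of geometric series.
\<close>

lemma card_bounded_patterns_le:
  fixes S :: "'a set" and L :: "'b set"
  assumes "finite S" "finite L"
  shows "finite {f \<in> S \<rightarrow>\<^sub>E UNIV \<times> L. (\<Sum>p\<in>S. fst (f p)) \<le> k}"
    and "card {f \<in> S \<rightarrow>\<^sub>E UNIV \<times> L. (\<Sum>p\<in>S. fst (f p)) \<le> k} \<le> 2 ^ k * (2 * card L) ^ card S"
proof -
  let ?F = "{f \<in> S \<rightarrow>\<^sub>E UNIV \<times> L. (\<Sum>p\<in>S. fst (f p)) \<le> k}"
  let ?G = "S \<rightarrow>\<^sub>E {..k} \<times> L"
  have sub: "?F \<subseteq> ?G"
  proof
    fix f assume f: "f \<in> ?F"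
    have "fst (f p) \<le> k" if "p \<in> S" for p
      using f member_le_sum[of p S "\<lambda>p. fst (f p)"] that assms by auto
    with f show "f \<in> ?G" by (fastforce simp: PiE_iff mem_Times_iff)
  qed
  have finG: "finite ?G" using assms by (intro finite_PiE) auto
  with sub show fin: "finite ?F" by (rule finite_subset)
  have geo: "(\<Sum>j\<le>k. (1 / 2 :: real) ^ j) \<le> 2"
    using geometric_sum[of "1/2 :: real" "Suc k"] by (simp add: lessThan_Suc_atMost)
  have "real (card ?F) * (1 / 2) ^ k = (\<Sum>f\<in>?F. (1 / 2) ^ k)" by simp
  also have "\<dots> \<le> (\<Sum>f\<in>?F. (1 / 2) ^ (\<Sum>p\<in>S. fst (f p)))"
    by (intro sum_mono power_decreasing) auto
  also have "\<dots> \<le> (\<Sum>f\<in>?G. (1 / 2) ^ (\<Sum>p\<in>S. fst (f p)))"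
    using finG sub by (intro sum_mono2) auto
  also have "\<dots> = (\<Prod>p\<in>S. \<Sum>v\<in>{..k} \<times> L. (1 / 2) ^ fst v)"
    using assms by (subst prod_sum_PiE) (auto simp: power_sum)
  also have "(\<Sum>v\<in>{..k} \<times> L. (1 / 2 :: real) ^ fst v) = real (card L) * (\<Sum>j\<le>k. (1 / 2) ^ j)"
    by (simp add: sum.cartesian_product' sum_distrib_left)
  also have "(\<Prod>p\<in>S. \<dots>) \<le> (\<Prod>p\<in>S. real (card L) * 2)"
    using geo by (intro prod_mono) (auto intro!: mult_left_mono sum_nonneg mult_nonneg_nonneg)
  finally have "real (card ?F) * (1 / 2) ^ k \<le> (2 * real (card L)) ^ card S"
    by (simp add: mult.commute)
  then have "real (card ?F) \<le> 2 ^ k * (2 * real (card L)) ^ card S"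
    by (simp add: field_simps)
  also have "\<dots> = real (2 ^ k * (2 * card L) ^ card S)" by simp
  finally show "card ?F \<le> 2 ^ k * (2 * card L) ^ card S" by (simp only: of_nat_le_iff)
qed

text \<open>
  The gap principle. With \<open>D c = lcm (b1 * c - 1) (b2 * c - 1)\<close>, the pattern of \<open>c\<close> records for each
  \<open>p \<in> S\<close> the number of whole units \<open>u\<close> in the contribution of \<open>p\<close> to \<open>ln (D c)\<close>, together with the
  information which of the two numbers provides the \<open>p\<close>-part of \<open>D c\<close>. The unit is chosen
  such that all rounding errors together are at most \<open>ln (W / 4)\<close>. Since \<open>ln (D c) \<ge> ln (W\<^sup>2 / 4)\<close>, two
  numbers \<open>c\<close>, \<open>c'\<close> with the same pattern satisfy \<open>ln (gcd (D c) (D c')) \<ge> ln W\<close>. On the other hand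
  \<open>gcd (D c) (D c')\<close> divides \<open>c' - c\<close>, prime by prime; this is where the second component of the
  pattern is used. The lower bound on \<open>W\<close> makes \<open>D c \<le> (W / 4) ^ 3\<close>, so a pattern has at most
  \<open>3 * card S\<close> units.
\<close>

lemma card_smooth_pairs_dyadic_le:
  fixes b1 b2 W :: nat
  assumes b: "0 < b1" "b1 < b2"
    and S: "finite S" "S \<noteq> {}" "\<And>p. p \<in> S \<Longrightarrow> prime p"
    and W: "256 * b1 * b2 \<le> W"
  shows "card {c \<in> {W..<2 * W}. prime_factors (b1 * c - 1) \<subseteq> S \<and> prime_factors (b2 * c - 1) \<subseteq> S}
           \<le> 32 ^ card S"
    (is "card ?A \<le> _")
proof -
  define D where "D = (\<lambda>c. lcm (b1 * c - 1) (b2 * c - 1))"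
  define u where "u = ln (real W / 4) / card S"
  define f where "f = (\<lambda>c p. nat \<lfloor>multiplicity p (D c) * ln p / u\<rfloor>)"
  define t where "t = (\<lambda>c p. multiplicity p (D c) = multiplicity p (b1 * c - 1))"
  define \<phi> where "\<phi> = (\<lambda>c. \<lambda>p\<in>S. (f c p, t c p))"
  have "256 * 1 * 1 \<le> 256 * b1 * b2" using b by (intro mult_le_mono) auto
  with W have W256: "256 \<le> W" by linarith
  have R: "card S > 0" using S by (simp add: card_gt_0_iff)
  have u: "u > 0" unfolding u_def using W256 R by auto
  have Ru: "card S * u = ln (real W) - ln 4"
    unfolding u_def using R W256 by (simp add: ln_div)

  have n: "b1 * c - 1 > 0" "b2 * c - 1 > 0" "c \<le> 2 * (b1 * c - 1)" "b2 * c \<le> 2 * (b2 * c - 1)"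
    if "c \<ge> W" for c
  proof -
    have "1 * c \<le> b1 * c" "1 * c \<le> b2 * c" using b by (intro mult_le_mono1; linarith)+
    with that W256
    show "b1 * c - 1 > 0" "b2 * c - 1 > 0" "c \<le> 2 * (b1 * c - 1)" "b2 * c \<le> 2 * (b2 * c - 1)"
      by linarith+
  qed
  have D_pos: "D c > 0" if "c \<ge> W" for c
    using n[OF that] by (auto simp: D_def intro!: Nat.gr0I)
  have D_lower: "W ^ 2 \<le> 4 * D c" if c: "c \<ge> W" for c
  proof -
    \<comment> \<open>The two numbers are almost coprime: their gcd divides \<open>b2 - b1\<close>.\<close>
    let ?n1 = "b1 * c - 1" and ?n2 = "b2 * c - 1"
    have "b1 * ?n2 - b2 * ?n1 = b2 - b1"
    proof -
      have "1 * b2 * 1 \<le> b1 * b2 * c" using b c W256 by (intro mult_le_mono) auto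
      moreover have "b1 * ?n2 = b1 * b2 * c - b1" "b2 * ?n1 = b1 * b2 * c - b2"
        by (simp_all add: diff_mult_distrib2 mult_ac)
      ultimately show ?thesis using b by linarith
    qed
    then have "gcd ?n1 ?n2 dvd b2 - b1"
      by (metis dvd_diff_nat dvd_mult gcd_dvd1 gcd_dvd2)
    then have "gcd ?n1 ?n2 \<le> b2 - b1" by (intro dvd_imp_le) (use b in auto)
    then have g: "gcd ?n1 ?n2 \<le> b2" by simp
    have "b2 * c ^ 2 = c * (b2 * c)" by (simp add: power2_eq_square)
    also have "\<dots> \<le> (2 * ?n1) * (2 * ?n2)" by (rule mult_le_mono[OF n(3,4)[OF c]])
    also have "\<dots> = 4 * (gcd ?n1 ?n2 * D c)"
      unfolding D_def by (subst prod_gcd_lcm_nat[symmetric]) simp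
    also have "\<dots> \<le> 4 * (b2 * D c)" using g by (intro mult_le_mono) auto
    finally have "b2 * c ^ 2 \<le> b2 * (4 * D c)" by simp
    then have "c ^ 2 \<le> 4 * D c" using b by simp
    moreover have "W ^ 2 \<le> c ^ 2" using c by (intro power_mono) auto
    ultimately show ?thesis by linarith
  qed
  have D_upper: "64 * D c \<le> W ^ 3" if c: "c \<in> {W..<2 * W}" for c
  proof -
    have "D c \<le> (b1 * c - 1) * (b2 * c - 1)" unfolding D_def
      using n[of c] c by (intro dvd_imp_le) auto
    also have "\<dots> \<le> (b1 * (2 * W)) * (b2 * (2 * W))"
      using c by (intro mult_le_mono order.trans[OF diff_le_self]) auto
    finally have "64 * D c \<le> (256 * b1 * b2) * W ^ 2" by (simp add: power2_eq_square mult_ac)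
    also have "\<dots> \<le> W * W ^ 2" using W by (intro mult_le_mono1)
    finally show ?thesis by (simp add: power3_eq_cube power2_eq_square)
  qed
  have D_factors: "prime_factors (D c) \<subseteq> S" if "c \<in> ?A" for c
  proof
    fix p assume "p \<in> prime_factors (D c)"
    then have p: "prime p" "p dvd D c" by auto
    have "D c dvd (b1 * c - 1) * (b2 * c - 1)" unfolding D_def by simp
    with p have "p dvd (b1 * c - 1) \<or> p dvd (b2 * c - 1)"
      using prime_dvd_mult_iff dvd_trans by blast
    with p that n[of c] show "p \<in> S" by (auto simp: prime_factors_dvd)
  qed
  have lnD: "ln (D c) = (\<Sum>p\<in>S. multiplicity p (D c) * ln p)" if "c \<in> ?A" for c
    using D_factors[OF that] D_pos[of c] that S by (intro ln_eq_sum_multiplicity) auto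
  have nonneg: "multiplicity p (D c) * ln p / u \<ge> 0" if "p \<in> S" for c p
    using S(3)[OF that] u by (auto intro!: divide_nonneg_pos mult_nonneg_nonneg dest: prime_gt_0_nat)
  have f_le: "f c p * u \<le> multiplicity p (D c) * ln p" if "p \<in> S" for c p
  proof -
    have "real (f c p) \<le> multiplicity p (D c) * ln p / u"
      unfolding f_def using nonneg[OF that, of c] by linarith
    with u show ?thesis by (simp add: field_simps)
  qed
  have f_ge: "f c p * u \<ge> multiplicity p (D c) * ln p - u" if "p \<in> S" for c p
  proof -
    have "real (f c p) \<ge> multiplicity p (D c) * ln p / u - 1"
      unfolding f_def using nonneg[OF that, of c] by linarith
    with u show ?thesis by (simp add: field_simps)
  qed

  have image: "\<phi> ` ?A \<subseteq> {g \<in> S \<rightarrow>\<^sub>E UNIV \<times> UNIV. (\<Sum>p\<in>S. fst (g p)) \<le> 3 * card S}"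
  proof (rule image_subsetI)
    fix c assume c': "c \<in> ?A"
    then have c: "c \<in> {W..<2 * W}" by simp
    have "(\<Sum>p\<in>S. f c p) * u = (\<Sum>p\<in>S. f c p * u)" by (simp add: sum_distrib_right)
    also have "\<dots> \<le> (\<Sum>p\<in>S. multiplicity p (D c) * ln p)" by (intro sum_mono f_le)
    also have "\<dots> = ln (D c)" using lnD[OF c'] by simp
    also have "\<dots> \<le> ln (real W ^ 3 / 64)"
    proof -
      have "real (64 * D c) \<le> real (W ^ 3)" using D_upper[OF c] by (simp only: of_nat_le_iff)
      then show ?thesis using D_pos[of c] c W256 by (subst ln_le_cancel_iff) auto
    qed
    also have "\<dots> = 3 * (ln W - ln 4)"
    proof -
      have "ln (64 :: real) = ln (4 ^ 3)" by simp
      also have "\<dots> = 3 * ln 4" by (subst ln_realpow) auto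
      finally show ?thesis using W256 by (simp add: ln_div ln_realpow)
    qed
    also have "\<dots> = 3 * card S * u" using Ru by simp
    finally have "real (\<Sum>p\<in>S. f c p) \<le> real (3 * card S)" using u by simp
    then have "(\<Sum>p\<in>S. f c p) \<le> 3 * card S" by (simp only: of_nat_le_iff)
    then have "(\<Sum>p\<in>S. fst (\<phi> c p)) \<le> 3 * card S" by (simp add: \<phi>_def)
    moreover have "\<phi> c \<in> S \<rightarrow>\<^sub>E UNIV \<times> UNIV" by (simp add: \<phi>_def)
    ultimately show "\<phi> c \<in> {g \<in> S \<rightarrow>\<^sub>E UNIV \<times> UNIV. (\<Sum>p\<in>S. fst (g p)) \<le> 3 * card S}"
      by blast
  qed

  have no_collision: False if c: "c \<in> ?A" "c' \<in> ?A" "c < c'" "\<phi> c = \<phi> c'" for c c'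
  proof -
    have same: "f c p = f c' p" "t c p = t c' p" if "p \<in> S" for p
      using fun_cong[OF c(4), of p] that by (simp_all add: \<phi>_def)
    define g where "g = gcd (D c) (D c')"
    have pos: "D c > 0" "D c' > 0" using D_pos c by auto
    then have g_pos: "g > 0" by (simp add: g_def)
    have g_factors: "prime_factors g \<subseteq> S"
      using D_factors[OF c(1)] pos g_pos by (auto simp: g_def prime_factors_dvd)
    have mult_g: "multiplicity p g = min (multiplicity p (D c)) (multiplicity p (D c'))" if "prime p" for p
      unfolding g_def using pos that by (intro multiplicity_gcd) auto
    have "g dvd c' - c"
    proof (rule multiplicity_le_imp_dvd)
      fix p :: nat assume p: "prime p"
      let ?q = "p ^ multiplicity p g"
      have "?q dvd c' - c"
      proof (cases "p \<in> S")
        case False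
        then have "multiplicity p g = 0"
          using g_factors p by (auto simp: prime_factors_multiplicity)
        then show ?thesis by simp
      next
        case True
        have cW: "c \<ge> W" "c' \<ge> W" using c by auto
        have qD: "?q dvd p ^ multiplicity p (D c)" "?q dvd p ^ multiplicity p (D c')"
          using p by (auto intro!: le_imp_power_dvd simp: mult_g)
        have multD: "multiplicity p (D x) = max (multiplicity p (b1 * x - 1)) (multiplicity p (b2 * x - 1))"
          if "x \<ge> W" for x
          unfolding D_def using n[OF that] p by (intro multiplicity_lcm) auto
        \<comment> \<open>As the labels agree, the \<open>p\<close>-parts of \<open>D c\<close> and \<open>D c'\<close> come from the same coefficient \<open>b\<close>.\<close>
        have "\<exists>b\<in>{b1, b2}. multiplicity p (D c) = multiplicity p (b * c - 1) \<and>
                multiplicity p (D c') = multiplicity p (b * c' - 1)"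
        proof (cases "t c p")
          case t: True
          with same[OF True] show ?thesis by (auto simp: t_def)
        next
          case t: False
          with same[OF True] multD[OF cW(1)] multD[OF cW(2)] show ?thesis
            by (auto simp: t_def max_def split: if_splits)
        qed
        then obtain b where b': "b \<in> {b1, b2}"
          "multiplicity p (D c) = multiplicity p (b * c - 1)"
          "multiplicity p (D c') = multiplicity p (b * c' - 1)" by blast
        have q: "?q dvd b * c - 1" "?q dvd b * c' - 1"
          using qD unfolding b' by (meson dvd_trans multiplicity_dvd)+
        have "b \<ge> 1" "c \<ge> 1" "c' \<ge> 1" using b'(1) b cW W256 by auto
        then have bc: "b * c \<ge> 1" "b * c' \<ge> 1" by simp_all
        have "?q dvd (b * c' - 1) - (b * c - 1)" using q by (rule dvd_diff_nat[rotated])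
        also have "(b * c' - 1) - (b * c - 1) = b * (c' - c)"
          using bc by (simp add: diff_mult_distrib2)
        finally have dvd: "?q dvd b * (c' - c)" .
        \<comment> \<open>Any divisor of \<open>b * c - 1\<close> is coprime to \<open>b\<close>, so the factor \<open>b\<close> may be cancelled.\<close>
        have "coprime ?q b"
        proof (rule coprimeI)
          fix d assume d: "d dvd ?q" "d dvd b"
          then have "d dvd b * c" "d dvd b * c - 1" using q(1) by (auto intro: dvd_trans)
          then have "d dvd b * c - (b * c - 1)" by (rule dvd_diff_nat)
          then show "is_unit d" using bc by simp
        qed
        with dvd show ?thesis by (simp add: coprime_dvd_mult_right_iff)
      qed
      then show "multiplicity p g \<le> multiplicity p (c' - c)"
        using c(3) p by (intro multiplicity_geI) auto
    qed (use g_pos in simp)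
    then have "g \<le> c' - c" using c(3) by (intro dvd_imp_le) auto
    also have "\<dots> < W" using c by auto
    finally have "ln g < ln W" using g_pos by simp
    have "2 * ln W - ln 4 \<le> ln (D c)"
    proof -
      have "real (W ^ 2) \<le> real (4 * D c)" using D_lower[of c] c by (simp only: of_nat_le_iff) simp
      then have "ln (real W ^ 2) \<le> ln (4 * real (D c))"
        using pos W256 by (subst ln_le_cancel_iff) auto
      then show ?thesis using pos W256 by (simp add: ln_realpow ln_mult)
    qed
    also have "\<dots> = (\<Sum>p\<in>S. multiplicity p (D c) * ln p)" by (rule lnD[OF c(1)])
    also have "\<dots> \<le> (\<Sum>p\<in>S. f c p * u + u)" using f_ge[of _ c] by (intro sum_mono) (simp add: algebra_simps)
    also have "\<dots> \<le> (\<Sum>p\<in>S. multiplicity p g * ln p + u)"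
    proof (intro sum_mono add_right_mono)
      fix p assume p: "p \<in> S"
      show "f c p * u \<le> multiplicity p g * ln p"
        using f_le[OF p, of c] f_le[OF p, of c'] same[OF p] mult_g[OF S(3)[OF p]] by (simp add: min_def)
    qed
    also have "\<dots> = ln g + card S * u"
      using ln_eq_sum_multiplicity[OF g_pos S(1) S(3) g_factors] by (simp add: sum.distrib)
    also have "\<dots> = ln g + (ln W - ln 4)" using Ru by simp
    finally show False using \<open>ln g < ln W\<close> by simp
  qed
  have "inj_on \<phi> ?A"
  proof (rule inj_onI)
    fix c c' assume "c \<in> ?A" "c' \<in> ?A" "\<phi> c = \<phi> c'"
    with no_collision[of c c'] no_collision[of c' c] show "c = c'" by (metis linorder_neqE_nat)
  qed
  then have "card ?A = card (\<phi> ` ?A)" by (simp add: card_image)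
  also have "\<dots> \<le> card {g \<in> S \<rightarrow>\<^sub>E UNIV \<times> (UNIV :: bool set). (\<Sum>p\<in>S. fst (g p)) \<le> 3 * card S}"
    using card_bounded_patterns_le(1)[OF S(1), of "UNIV :: bool set"] image by (intro card_mono) auto
  also have "\<dots> \<le> 2 ^ (3 * card S) * (2 * card (UNIV :: bool set)) ^ card S"
    using card_bounded_patterns_le(2)[OF S(1), of "UNIV :: bool set"] by auto
  also have "\<dots> = 32 ^ card S" by (simp add: power_mult power_mult_distrib[symmetric])
  finally show ?thesis .
qed

lemma card_smooth_pairs_le:
  fixes b1 b2 j k :: nat
  assumes "0 < b1" "b1 < b2" "finite S" "S \<noteq> {}" "\<And>p. p \<in> S \<Longrightarrow> prime p"
    and "256 * b1 * b2 \<le> 2 ^ j"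
  shows "card {c \<in> {2 ^ j..<2 ^ k}. prime_factors (b1 * c - 1) \<subseteq> S \<and> prime_factors (b2 * c - 1) \<subseteq> S}
           \<le> k * 32 ^ card S"
proof (induction k)
  case (Suc k)
  let ?A = "\<lambda>l h. {c \<in> {l..<h}. prime_factors (b1 * c - 1) \<subseteq> S \<and> prime_factors (b2 * c - 1) \<subseteq> S}"
  show ?case
  proof (cases "j \<le> k")
    case True
    then have "256 * b1 * b2 \<le> 2 ^ k"
      using assms(6) power_increasing[OF True, of "2::nat"] by linarith
    then have "card (?A (2 ^ k) (2 * 2 ^ k)) \<le> 32 ^ card S"
      using assms by (intro card_smooth_pairs_dyadic_le) auto
    moreover have "card (?A (2 ^ j) (2 ^ Suc k)) \<le> card (?A (2 ^ j) (2 ^ k) \<union> ?A (2 ^ k) (2 * 2 ^ k))"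
      by (intro card_mono) auto
    moreover have "\<dots> \<le> card (?A (2 ^ j) (2 ^ k)) + card (?A (2 ^ k) (2 * 2 ^ k))"
      by (rule card_Un_le)
    ultimately show ?thesis using Suc.IH by simp
  next
    case False
    then have "(2 :: nat) ^ Suc k \<le> 2 ^ j" by (intro power_increasing) auto
    then have "{2 ^ j..<2 ^ Suc k} = ({} :: nat set)" by simp
    then show ?thesis by simp
  qed
qed simp

section \<open>The supply of smooth numbers\<close>

definition primes_le :: "real \<Rightarrow> nat set" where
  "primes_le z = {p. prime p \<and> real p \<le> z}"

lemma primes_le_eq: "z \<ge> 0 \<Longrightarrow> primes_le z = {p. prime p \<and> p \<le> nat \<lfloor>z\<rfloor>}"
  by (auto simp: primes_le_def le_nat_floor) linarith

lemma finite_primes_le [simp]: "finite (primes_le z)"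
proof (rule finite_subset)
  show "primes_le z \<subseteq> {..nat \<lfloor>z\<rfloor>}" by (auto simp: primes_le_def le_nat_floor)
qed simp

lemma prime_primes_le: "p \<in> primes_le z \<Longrightarrow> prime p"
  by (simp add: primes_le_def)

lemma primes_le_mono: "z \<le> z' \<Longrightarrow> primes_le z \<subseteq> primes_le z'"
  by (auto simp: primes_le_def)

lemma card_primes_le_le:
  assumes "z \<le> real k"
  shows "card (primes_le z) \<le> k"
proof -
  have "primes_le z \<subseteq> {1..k}"
    using assms by (auto simp: primes_le_def Suc_le_eq dest: prime_gt_0_nat)
  from card_mono[OF _ this] show ?thesis by simp
qed

lemma smooth_numbers_iff:
  assumes "n \<ge> 2"
  shows "n \<in> smooth_numbers y \<longleftrightarrow> prime_factors n \<subseteq> primes_le (y n)"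
proof -
  have "prime_factors n \<noteq> {}"
    using assms prime_factor_nat[of n] by (auto simp: prime_factors_dvd)
  then have "real (Max (prime_factors n)) \<le> y n \<longleftrightarrow> (\<forall>p\<in>prime_factors n. real p \<le> y n)"
    by (meson Max_ge Max_in finite_set_mset of_nat_le_iff order_trans)
  with assms show ?thesis
    by (auto simp: smooth_numbers_def greatest_prime_factor_def primes_le_def)
qed

text \<open>
  Exponents between \<open>m + 1\<close> and \<open>2 * m\<close> place the product of the prime powers between
  \<open>\<Prod>S ^ (m + 1) > X\<close> and \<open>\<Prod>S ^ (2 * m) \<le> X\<^sup>2\<close>. The lower end matters because smoothness of \<open>n\<close> is
  measured by \<open>y n\<close>, which is only known to be at least \<open>y X\<close> once \<open>n \<ge> X\<close>.
\<close>

lemma power_card_le_card_smooth: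
  fixes X m :: nat
  assumes S: "finite S" "\<And>p. p \<in> S \<Longrightarrow> prime p"
    and X: "\<Prod>S ^ m \<le> X" "X < \<Prod>S ^ (m + 1)"
  shows "m ^ card S \<le> card {n \<in> {X<..X ^ 2}. prime_factors n \<subseteq> S}"
proof -
  let ?E = "S \<rightarrow>\<^sub>E {m + 1..2 * m}"
  let ?n = "\<lambda>e. \<Prod>p\<in>S. p ^ e p"
  have ge1: "p \<ge> 1" if "p \<in> S" for p using S(2)[OF that] prime_ge_1_nat by blast
  have mult: "multiplicity p (?n e) = (if p \<in> S then e p else 0)" if "prime p" for p e
    using S that by (intro multiplicity_prod_prime_powers) auto
  have "inj_on ?n ?E"
  proof (rule inj_onI)
    fix e e' assume e: "e \<in> ?E" "e' \<in> ?E" "?n e = ?n e'"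
    show "e = e'"
    proof (rule PiE_ext[OF e(1,2)])
      fix p assume "p \<in> S"
      with mult[of p e] mult[of p e'] S(2) e(3) show "e p = e' p" by simp
    qed
  qed
  then have "card (?n ` ?E) = m ^ card S"
    using S by (simp add: card_image card_PiE)
  moreover have "?n ` ?E \<subseteq> {n \<in> {X<..X ^ 2}. prime_factors n \<subseteq> S}"
  proof safe
    fix e assume e: "e \<in> ?E"
    have "\<Prod>S ^ (m + 1) = (\<Prod>p\<in>S. p ^ (m + 1))" by (simp only: prod_power_distrib)
    also have "\<dots> \<le> ?n e"
      using e ge1 by (intro prod_mono conjI power_increasing) (auto simp: PiE_iff)
    finally show "?n e \<in> {X<..X ^ 2}"
    proof (intro greaterThanAtMost_iff[THEN iffD2] conjI)
      have "?n e \<le> (\<Prod>p\<in>S. p ^ (2 * m))"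
        using e ge1 by (intro prod_mono conjI power_increasing) (auto simp: PiE_iff)
      also have "\<dots> = (\<Prod>S ^ m) ^ 2"
        by (simp only: prod_power_distrib power_mult[symmetric] mult.commute)
      also have "\<dots> \<le> X ^ 2" using X(1) by (rule power_mono) simp
      finally show "?n e \<le> X ^ 2" .
    qed (use X(2) in linarith)
    fix p assume "p \<in> prime_factors (?n e)"
    then have "prime p" "multiplicity p (?n e) > 0"
      by (auto simp: prime_factors_multiplicity)
    with mult[of p e] show "p \<in> S" by (simp split: if_splits)
  qed
  then have "card (?n ` ?E) \<le> card {n \<in> {X<..X ^ 2}. prime_factors n \<subseteq> S}"
    by (intro card_mono) auto
  ultimately show ?thesis by simp
qed

section \<open>Comparing the two counts\<close>

text \<open>
  The function \<open>y\<close> may jump, so for many \<open>X\<close> its values at \<open>X\<close> and near \<open>X\<^sup>2\<close> can be of very different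
  size. But if \<open>g\<close> more than tripled at every step of the orbit of \<open>a \<mapsto> 2 * a + k\<close>, which grows like
  \<open>2 ^ i\<close>, then \<open>g\<close> could not stay below the identity.
\<close>

lemma exists_slow_doubling:
  fixes g :: "nat \<Rightarrow> nat"
  assumes le: "\<forall>\<^sub>F a in sequentially. g a \<le> a" and pos: "\<forall>\<^sub>F a in sequentially. g a > 0"
  shows "\<exists>a\<ge>A. g (2 * a + k) \<le> 3 * g a"
proof (rule ccontr)
  assume "\<not> ?thesis"
  then have fast: "3 * g a < g (2 * a + k)" if "a \<ge> A" for a using that by force
  from eventually_conj[OF le pos] obtain a0 where a0: "\<And>a. a \<ge> a0 \<Longrightarrow> g a \<le> a \<and> g a > 0"
    by (auto simp: eventually_sequentially)
  define s where "s = max A a0"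
  define a where "a = (\<lambda>i. 2 ^ i * (s + k) - k)"
  have ak: "a i + k = 2 ^ i * (s + k)" and as: "a i \<ge> s" for i
  proof -
    have "s + k \<le> 2 ^ i * (s + k)" by simp
    then show "a i + k = 2 ^ i * (s + k)" "a i \<ge> s" unfolding a_def by linarith+
  qed
  have a_Suc: "a (Suc i) = 2 * a i + k" for i using ak[of i] ak[of "Suc i"] by simp
  have "3 ^ i \<le> g (a i)" for i
  proof (induction i)
    case 0
    have "a 0 \<ge> a0" using as[of 0] by (simp add: s_def)
    with a0 show ?case by (simp add: Suc_le_eq)
  next
    case (Suc i)
    then show ?case using fast[of "a i"] as[of i] by (simp add: a_Suc s_def)
  qed
  moreover have "g (a i) \<le> a i" for i using a0[of "a i"] as[of i] by (simp add: s_def)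
  moreover have "a i \<le> 2 ^ i * (s + k)" for i using ak[of i] by simp
  ultimately have "3 ^ i \<le> 2 ^ i * (s + k)" for i by (meson le_trans)
  then have "(3 / 2) ^ i \<le> real (s + k)" for i
  proof -
    have "real (3 ^ i) \<le> real (2 ^ i * (s + k))"
      using \<open>3 ^ i \<le> 2 ^ i * (s + k)\<close> by (simp only: of_nat_le_iff)
    then show ?thesis by (simp add: power_divide field_simps)
  qed
  moreover obtain i where "real (s + k) < (3 / 2) ^ i" using real_arch_pow[of "3/2"] by auto
  ultimately show False by (meson not_le)
qed

text \<open>
  The comparison of the two counts, with \<open>X = 2 ^ a\<close>, \<open>z = y X\<close>, and \<open>r\<close> and \<open>P\<close> the number and the
  product of the primes up to \<open>z\<close>. The exponent \<open>m\<close> is the integer part of \<open>ln X / ln P\<close>. The factor \<open>9 * a\<^sup>2\<close> is absorbed by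
  \<open>2 ^ r\<close> if \<open>r\<close> is large. If it is not, then \<open>ln P \<le> r * ln a\<close> is of order at most
  \<open>(ln a)\<^sup>2\<close> and \<open>m\<close> exceeds \<open>2 ^ 30 * sqrt a\<close>; five factors \<open>sqrt a\<close> suffice to beat \<open>9 * a\<^sup>2\<close>,
  and \<open>z \<ge> 11\<close> ensures \<open>r \<ge> 5\<close>.
\<close>

lemma eventually_exponent_bound:
  "\<forall>\<^sub>F a::nat in sequentially. \<forall>z. 11 \<le> z \<longrightarrow> z < 2 powi (-32) * ln (2 ^ a) \<longrightarrow>
     (\<exists>m. \<Prod>(primes_le z) ^ m \<le> 2 ^ a \<and> 2 ^ a < \<Prod>(primes_le z) ^ (m + 1) \<and>
        9 * a\<^sup>2 * 2 ^ (30 * card (primes_le z)) < m ^ card (primes_le z))"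
proof -
  have "\<forall>\<^sub>F a::nat in sequentially. a * (ln 2)\<^sup>2 / (ln (9 * real a ^ 2) * ln a) \<ge> 2 ^ 30 * sqrt a + 1"
    by real_asymp
  moreover have "\<forall>\<^sub>F a::nat in sequentially. sqrt a ^ 5 > 9 * real a ^ 2"
    by real_asymp
  ultimately show ?thesis using eventually_ge_at_top[of 2]
  proof eventually_elim
    case (elim a)
    show ?case
    proof (intro allI impI)
      fix z :: real assume z: "11 \<le> z" "z < 2 powi (-32) * ln (2 ^ a)"
      define S where "S = primes_le z"
      define q where "q = a * ln 2 / ln (real (\<Prod>S))"
      define m where "m = nat \<lfloor>q\<rfloor>"
      have z_less: "2 ^ 32 * z < a * ln 2"
        using z(2) by (simp add: power_int_minus ln_realpow field_simps)
      have ln2: "0 < ln (2::real)" "ln (2::real) \<le> 1" using ln_le_minus_one[of "2::real"] by auto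
      have "a * ln 2 \<le> a * (1::real)" using ln2 by (intro mult_left_mono) auto
      moreover have "z \<le> 2 ^ 32 * z" using z(1) by simp
      ultimately have za: "z \<le> a" using z_less by linarith
      have S: "finite S" "\<And>p. p \<in> S \<Longrightarrow> prime p" by (auto simp: S_def prime_primes_le)
      have "{2, 3, 5, 7, 11} \<subseteq> S" using z(1) by (auto simp: S_def primes_le_def)
      from card_mono[OF S(1) this] have r: "card S \<ge> 5" by simp
      have S0: "0 \<notin> S" using S(2)[of 0] by auto
      then have P0: "\<Prod>S > 0" using S(1) by (auto intro!: prod_pos Nat.gr0I)
      have "2 \<in> S" using \<open>{2, 3, 5, 7, 11} \<subseteq> S\<close> by simp
      then have "2 dvd \<Prod>S" using S(1) by (rule dvd_prodI[rotated])
      then have P2: "\<Prod>S \<ge> 2" using P0 by (rule dvd_imp_le)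
      then have lnP: "ln (real (\<Prod>S)) > 0" by (simp only: ln_gt_zero_iff)
      have q0: "q \<ge> 0" unfolding q_def using lnP by simp
      have "real m \<le> q" "q < real m + 1" unfolding m_def using q0 by linarith+
      then have m: "m * ln (real (\<Prod>S)) \<le> a * ln 2" "a * ln 2 < (m + 1) * ln (real (\<Prod>S))"
        unfolding q_def using lnP by (simp_all add: field_simps)
      have "ln (real (\<Prod>S ^ m)) \<le> ln (real (2 ^ a))"
        using m(1) P0 by (simp add: ln_realpow del: of_nat_prod)
      then have le: "\<Prod>S ^ m \<le> 2 ^ a"
        using P0 by (subst (asm) ln_le_cancel_iff) (simp_all only: of_nat_le_iff of_nat_0_less_iff zero_less_power zero_less_numeral)
      have "ln (real (2 ^ a)) < ln (real (\<Prod>S ^ (m + 1)))"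
        using m(2) P0 by (simp add: ln_realpow ln_mult algebra_simps del: of_nat_prod)
      then have less: "2 ^ a < \<Prod>S ^ (m + 1)"
        using P0 by (subst (asm) ln_less_cancel_iff) (simp_all only: of_nat_less_iff of_nat_0_less_iff zero_less_power zero_less_numeral)
      have "9 * a\<^sup>2 * 2 ^ (30 * card S) < m ^ card S"
      proof (cases "9 * a\<^sup>2 < 2 ^ card S")
        case True
        have "\<Prod>S \<le> 4 ^ nat \<lfloor>z\<rfloor>"
          unfolding S_def using z(1) by (subst primes_le_eq) (auto intro: primorial_le_four_power)
        then have "real (\<Prod>S) \<le> real (4 ^ nat \<lfloor>z\<rfloor>)" by (simp only: of_nat_le_iff)
        then have "ln (real (\<Prod>S)) \<le> ln (real (4 ^ nat \<lfloor>z\<rfloor>))"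
          using P0 by (subst ln_le_cancel_iff) (simp_all del: of_nat_prod)
        also have "\<dots> = real (nat \<lfloor>z\<rfloor>) * ln (2 ^ 2)" by (simp add: ln_realpow)
        also have "\<dots> \<le> z * (2 * ln 2)"
          using z(1) by (subst ln_realpow) (auto intro!: mult_mono)
        also have "\<dots> \<le> z * 2" using z(1) ln2 by (intro mult_left_mono) auto
        finally have "2 ^ 31 * ln (real (\<Prod>S)) \<le> 2 ^ 31 * (z * 2)" by simp
        then have "2 ^ 31 * ln (real (\<Prod>S)) \<le> a * ln 2" using z_less by simp
        then have "q \<ge> 2 ^ 31" unfolding q_def using lnP by (simp add: field_simps)
        then have "real (2 ^ 31) < real (m + 1)" using \<open>q < real m + 1\<close> by simp
        then have "2 ^ 31 < m + 1" by (simp only: of_nat_less_iff)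
        then have "m \<ge> 2 ^ 31" by simp
        then have "(2 ^ 31) ^ card S \<le> m ^ card S" by (rule power_mono) simp
        moreover have "((2 :: nat) ^ 31) ^ card S = 2 ^ card S * 2 ^ (30 * card S)"
          by (simp only: power_mult[symmetric] power_add[symmetric]) simp
        moreover have "9 * a\<^sup>2 * 2 ^ (30 * card S) < 2 ^ card S * 2 ^ (30 * card S)"
          using True by (rule mult_strict_right_mono) simp
        ultimately show ?thesis by linarith
      next
        case False
        have "\<Prod>S \<le> (\<Prod>p\<in>S. a)"
          using za by (intro prod_mono) (auto simp: S_def primes_le_def)
        then have "\<Prod>S \<le> a ^ card S" by simp
        then have "real (\<Prod>S) \<le> real (a ^ card S)" by (simp only: of_nat_le_iff)
        then have "ln (real (\<Prod>S)) \<le> ln (real (a ^ card S))"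
          using P0 elim(3) by (subst ln_le_cancel_iff) (simp_all del: of_nat_prod)
        also have "\<dots> = card S * ln a" using elim(3) by (simp add: ln_realpow)
        finally have lnP_le: "ln (real (\<Prod>S)) \<le> card S * ln a" .
        have "real (2 ^ card S) \<le> real (9 * a\<^sup>2)" using False by (simp only: of_nat_le_iff not_less)
        then have "ln (2 ^ card S) \<le> ln (9 * real a ^ 2)"
          using elim(3) by (subst ln_le_cancel_iff) auto
        then have r_le: "card S * ln 2 \<le> ln (9 * real a ^ 2)" by (simp add: ln_realpow)
        have lna: "ln (real a) > 0" using elim(3) by simp
        have "ln 2 * ln (real (\<Prod>S)) \<le> ln 2 * (card S * ln a)"
          using lnP_le ln2 by (intro mult_left_mono) auto
        also have "\<dots> \<le> ln (9 * real a ^ 2) * ln a"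
          using mult_right_mono[OF r_le, of "ln a"] lna by (simp add: mult_ac)
        finally have *: "ln 2 * ln (real (\<Prod>S)) \<le> ln (9 * real a ^ 2) * ln a" .
        have "2 ^ 30 * sqrt a + 1 \<le> a * (ln 2)\<^sup>2 / (ln (9 * real a ^ 2) * ln a)" by (rule elim(1))
        also have "\<dots> \<le> a * (ln 2)\<^sup>2 / (ln 2 * ln (real (\<Prod>S)))"
          using * mult_pos_pos[OF ln2(1) lnP]
          by (intro divide_left_mono mult_pos_pos[OF ln2(1) lnP]) (simp_all del: of_nat_prod)
        also have "\<dots> = q" using ln2 by (simp add: q_def power2_eq_square)
        finally have "2 ^ 30 * sqrt a \<le> m" using \<open>q < real m + 1\<close> by linarith
        then have "(2 ^ 30 * sqrt a) ^ card S \<le> real m ^ card S" by (rule power_mono) simp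
        moreover have "2 ^ (30 * card S) * sqrt a ^ card S = (2 ^ 30 * sqrt a) ^ card S"
          by (simp add: power_mult power_mult_distrib)
        moreover have "sqrt a ^ 5 \<le> sqrt a ^ card S" using r elim(3) by (intro power_increasing) auto
        then have "9 * real a ^ 2 < sqrt a ^ card S" using elim(2) by linarith
        then have "2 ^ (30 * card S) * (9 * real a ^ 2) < 2 ^ (30 * card S) * sqrt a ^ card S" by simp
        ultimately have "2 ^ (30 * card S) * (9 * real a ^ 2) < real m ^ card S" by linarith
        then have "real (9 * a\<^sup>2 * 2 ^ (30 * card S)) < real (m ^ card S)" by (simp add: mult_ac)
        then show ?thesis by (simp only: of_nat_less_iff)
      qed
      with le less show "\<exists>m. \<Prod>(primes_le z) ^ m \<le> 2 ^ a \<and> 2 ^ a < \<Prod>(primes_le z) ^ (m + 1) \<and>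
          9 * a\<^sup>2 * 2 ^ (30 * card (primes_le z)) < m ^ card (primes_le z)"
        unfolding S_def by blast
    qed
  qed
qed

section \<open>Multiplicative decompositions of the shifted smooth numbers\<close>

text \<open>
  The elements of one factor \<open>C\<close> of \<open>A = B * C\<close> up to \<open>2 ^ (2 * a) + 1\<close>, that is, up to \<open>X\<^sup>2 + 1\<close> for
  \<open>X = 2 ^ a\<close>; here \<open>b1\<close> and \<open>b2\<close> are elements of the other factor. Elements below a constant
  \<open>2 ^ j\<close> are counted trivially. For the others \<open>b2 * c - 1 \<le> 2 ^ (2 * a + k)\<close>, so monotonicity of
  \<open>y\<close> confines all primes in question to a single set.
\<close>

lemma factor_count_le:
  fixes y :: "nat \<Rightarrow> real" and b1 b2 k :: nat
  assumes b: "0 < b1" "b1 < b2" "2 * b2 \<le> 2 ^ k"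
    and y: "mono_on {1..} y"
    and C: "\<And>c. c \<in> C \<Longrightarrow> c \<ge> K \<Longrightarrow> b1 * c - 1 \<in> smooth_numbers y \<and> b2 * c - 1 \<in> smooth_numbers y"
  shows "\<forall>\<^sub>F a in sequentially. primes_le (y (2 ^ (2 * a + k))) \<noteq> {} \<longrightarrow>
           card (C \<inter> {..2 ^ (2 * a) + 1}) \<le> 3 * a * 32 ^ card (primes_le (y (2 ^ (2 * a + k))))"
proof -
  define j where "j = 256 * b1 * b2 + K + 3"
  have "j < 2 ^ j" by (rule less_exp)
  moreover have "256 * b1 * b2 \<le> j" "K \<le> j" "3 \<le> j" by (simp_all add: j_def)
  ultimately have j: "256 * b1 * b2 \<le> 2 ^ j" "K \<le> 2 ^ j" "3 \<le> (2::nat) ^ j" by linarith+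
  show ?thesis
    using eventually_ge_at_top[of "2 ^ j + 1"]
  proof eventually_elim
    case (elim a)
    show ?case
    proof
      let ?S = "primes_le (y (2 ^ (2 * a + k)))"
      let ?A = "{c \<in> {2 ^ j..<2 ^ (2 * a + 1)}. prime_factors (b1 * c - 1) \<subseteq> ?S \<and> prime_factors (b2 * c - 1) \<subseteq> ?S}"
      assume S: "?S \<noteq> {}"
      have N: "(2::nat) ^ (2 * a) + 1 < 2 ^ (2 * a + 1)"
        using elim j(3) power_gt1[of "2::nat" "2 * a - 1"] by (simp add: algebra_simps)
      have "C \<inter> {..2 ^ (2 * a) + 1} \<subseteq> {..<2 ^ j} \<union> ?A"
      proof
        fix c assume c: "c \<in> C \<inter> {..2 ^ (2 * a) + 1}"
        show "c \<in> {..<2 ^ j} \<union> ?A"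
        proof (cases "c < 2 ^ j")
          case False
          have smooth: "prime_factors (b * c - 1) \<subseteq> ?S"
            if b': "b \<in> {b1, b2}" and mem: "b * c - 1 \<in> smooth_numbers y" for b
          proof -
            have "1 * c \<le> b * c" using b b' by (intro mult_le_mono1) auto
            with False j(3) have ge2: "b * c - 1 \<ge> 2" by linarith
            have "b * c \<le> b2 * 2 ^ (2 * a + 1)"
              using c b b' N by (intro mult_le_mono) auto
            also have "\<dots> = (2 * b2) * 2 ^ (2 * a)" by simp
            also have "\<dots> \<le> 2 ^ k * 2 ^ (2 * a)" using b(3) by (rule mult_le_mono1)
            finally have "b * c - 1 \<le> 2 ^ (2 * a + k)" by (simp add: power_add mult_ac)
            then have "y (b * c - 1) \<le> y (2 ^ (2 * a + k))"
              using ge2 by (intro mono_onD[OF y]) auto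
            with mem ge2 show ?thesis
              using primes_le_mono by (auto simp: smooth_numbers_iff)
          qed
          have "b1 * c - 1 \<in> smooth_numbers y \<and> b2 * c - 1 \<in> smooth_numbers y"
            using c False j(2) by (intro C) auto
          with smooth[of b1] smooth[of b2] c False N show ?thesis by auto
        qed simp
      qed
      then have "card (C \<inter> {..2 ^ (2 * a) + 1}) \<le> card ({..<2 ^ j} \<union> ?A)"
        by (intro card_mono) auto
      also have "\<dots> \<le> card {..<(2::nat) ^ j} + card ?A" by (rule card_Un_le)
      also have "card ?A \<le> (2 * a + 1) * 32 ^ card ?S"
        using b S j by (intro card_smooth_pairs_le) (auto dest: prime_primes_le)
      also have "card {..<(2::nat) ^ j} \<le> 2 ^ j * 32 ^ card ?S" by simp
      finally have "card (C \<inter> {..2 ^ (2 * a) + 1}) \<le> (2 ^ j + (2 * a + 1)) * 32 ^ card ?S"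
        by (simp add: algebra_simps)
      also have "\<dots> \<le> 3 * a * 32 ^ card ?S" using elim by (intro mult_le_mono1) auto
      finally show "card (C \<inter> {..2 ^ (2 * a) + 1}) \<le> 3 * a * 32 ^ card ?S" .
    qed
  qed
qed

lemma two_elements:
  fixes B :: "nat set"
  assumes "B \<subseteq> {1..}" "infinite B \<or> card B \<ge> 2"
  obtains b1 b2 where "b1 \<in> B" "b2 \<in> B" "0 < b1" "b1 < b2"
proof -
  have "\<not> (\<exists>x. B \<subseteq> {x})"
  proof
    assume "\<exists>x. B \<subseteq> {x}"
    then obtain x where x: "B \<subseteq> {x}" ..
    then have "finite B" "card B \<le> 1" using finite_subset[OF x] card_mono[OF _ x] by auto
    with assms(2) show False by simp
  qed
  then obtain x x' where x: "x \<in> B" "x' \<in> B" "x \<noteq> x'" by blast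
  with assms(1) that[of x x'] that[of x' x] show ?thesis
    by (cases "x < x'") (auto simp: Suc_le_eq)
qed

text \<open>
  All large powers of \<open>2\<close> are smooth, because \<open>y\<close> eventually exceeds \<open>2\<close>.
\<close>

lemma infinite_smooth_numbers:
  assumes y: "filterlim y at_top sequentially"
  shows "infinite (smooth_numbers y)"
proof -
  have "\<forall>\<^sub>F n in sequentially. 2 \<le> y n" using y by (simp add: filterlim_at_top)
  then obtain n0 where n0: "\<And>n. n \<ge> n0 \<Longrightarrow> 2 \<le> y n" by (auto simp: eventually_sequentially)
  have "(\<lambda>i. 2 ^ i) ` {n0 + 1..} \<subseteq> smooth_numbers y"
  proof safe
    fix i assume i: "i \<ge> n0 + 1"
    have "i < 2 ^ i" by (rule less_exp)
    with i have "2 \<le> y (2 ^ i)" by (intro n0) linarith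
    moreover have "(2::nat) ^ 1 \<le> 2 ^ i" using i by (intro power_increasing) auto
    moreover have "p = 2" if "p \<in> prime_factors (2 ^ i)" for p :: nat
    proof (rule primes_dvd_imp_eq)
      show "prime p" using that by (rule in_prime_factors_imp_prime)
      moreover have "p dvd 2 ^ i" using that by (rule in_prime_factors_imp_dvd)
      ultimately show "p dvd 2" by (rule prime_dvd_power)
    qed simp
    then have "prime_factors ((2::nat) ^ i) \<subseteq> {2}" by blast
    moreover have "{2} \<subseteq> primes_le (y (2 ^ i))"
      using \<open>2 \<le> y (2 ^ i)\<close> by (simp add: primes_le_def)
    ultimately have "prime_factors (2 ^ i) \<subseteq> primes_le (y (2 ^ i))" by blast
    then show "2 ^ i \<in> smooth_numbers y"
      using \<open>(2::nat) ^ 1 \<le> 2 ^ i\<close> by (subst smooth_numbers_iff) simp_all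
  qed
  moreover have "infinite ((\<lambda>i. 2 ^ i :: nat) ` {n0 + 1..})"
    by (subst finite_image_iff) (auto simp: inj_on_def infinite_Ici)
  ultimately show ?thesis using finite_subset by blast
qed

text \<open>
  The smooth numbers \<open>T\<close> supplied by \<open>power_card_le_card_smooth\<close>, shifted by \<open>1\<close>, all lie in
  \<open>B * C\<close>, so \<open>card T\<close> is at most the product of the two counting functions bounded by
  \<open>factor_count_le\<close>; an \<open>a\<close> from \<open>exists_slow_doubling\<close> makes this impossible.
\<close>

lemma not_m_reducible_asymp_eq_shifted_smooth:
  fixes y :: "nat \<Rightarrow> real"
  assumes y: "mono_on {1..} y" "filterlim y at_top sequentially"
    and y_less: "\<forall>\<^sub>F n in sequentially. y n < 2 powi (-32) * ln (real n)"
    and asymp: "asymp_eq_sets A (smooth_numbers y + {1})"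
  shows "\<not> m_reducible A"
proof
  assume "m_reducible A"
  then obtain B C where BC: "B \<subseteq> {1..}" "C \<subseteq> {1..}" "infinite B \<or> card B \<ge> 2"
    "infinite C \<or> card C \<ge> 2" "A = B * C"
    unfolding m_reducible_def by blast
  obtain b1 b2 where b: "b1 \<in> B" "b2 \<in> B" "0 < b1" "b1 < b2"
    using two_elements[OF BC(1,3)] .
  obtain c1 c2 where c: "c1 \<in> C" "c2 \<in> C" "0 < c1" "c1 < c2"
    using two_elements[OF BC(2,4)] .
  obtain K where K: "A \<inter> {K..} = (smooth_numbers y + {1}) \<inter> {K..}"
    using asymp unfolding asymp_eq_sets_def by blast
  have A_iff: "n + 1 \<in> A \<longleftrightarrow> n \<in> smooth_numbers y" if "n + 1 \<ge> K" for n
  proof -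
    have "n + 1 \<in> A \<longleftrightarrow> n + 1 \<in> smooth_numbers y + {1}" using K that by blast
    also have "\<dots> \<longleftrightarrow> n \<in> smooth_numbers y" by (auto simp: set_plus_def)
    finally show ?thesis .
  qed
  have smooth: "b * c - 1 \<in> smooth_numbers y" if "b \<in> B" "c \<in> C" "b * c \<ge> K" for b c
  proof -
    have "b * c \<ge> 1" using that BC(1,2) by (auto simp: Suc_le_eq subset_iff)
    moreover have "b * c \<in> A" using that BC(5) by (auto simp: set_times_def)
    ultimately show ?thesis using A_iff[of "b * c - 1"] that by simp
  qed

  \<comment> \<open>Any \<open>k\<close> with \<open>2 * b2 \<le> 2 ^ k\<close> and \<open>2 * c2 \<le> 2 ^ k\<close> will do.\<close>
  define k where "k = 2 * b2 + 2 * c2"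
  have "k < 2 ^ k" by (rule less_exp)
  moreover have "2 * b2 \<le> k" "2 * c2 \<le> k" by (simp_all add: k_def)
  ultimately have k: "2 * b2 \<le> 2 ^ k" "2 * c2 \<le> 2 ^ k" by linarith+
  define S where "S = (\<lambda>a. primes_le (y (2 ^ a)))"
  have le_mult: "x \<le> z * x" if "0 < z" for x z :: nat using that by simp
  have count_C: "\<forall>\<^sub>F a in sequentially. S (2 * a + k) \<noteq> {} \<longrightarrow>
      card (C \<inter> {..2 ^ (2 * a) + 1}) \<le> 3 * a * 32 ^ card (S (2 * a + k))"
    unfolding S_def
  proof (rule factor_count_le[OF b(3,4) k(1) y(1)])
    fix x assume x: "x \<in> C" "x \<ge> K"
    have "K \<le> b1 * x" "K \<le> b2 * x" using le_mult[of b1 x] le_mult[of b2 x] b x by linarith+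
    with x b show "b1 * x - 1 \<in> smooth_numbers y \<and> b2 * x - 1 \<in> smooth_numbers y"
      by (blast intro: smooth)
  qed
  have count_B: "\<forall>\<^sub>F a in sequentially. S (2 * a + k) \<noteq> {} \<longrightarrow>
      card (B \<inter> {..2 ^ (2 * a) + 1}) \<le> 3 * a * 32 ^ card (S (2 * a + k))"
    unfolding S_def
  proof (rule factor_count_le[OF c(3,4) k(2) y(1)])
    fix x assume x: "x \<in> B" "x \<ge> K"
    have "K \<le> c1 * x" "K \<le> c2 * x" using le_mult[of c1 x] le_mult[of c2 x] c x by linarith+
    with smooth[OF x(1) c(1)] smooth[OF x(1) c(2)]
    show "c1 * x - 1 \<in> smooth_numbers y \<and> c2 * x - 1 \<in> smooth_numbers y"
      by (simp add: mult.commute)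
  qed
  have pow: "filterlim (\<lambda>a::nat. 2 ^ a :: nat) sequentially sequentially"
    by (rule filterlim_at_top_mono[OF filterlim_ident]) (auto intro!: always_eventually less_imp_le less_exp)
  have small: "\<forall>\<^sub>F a in sequentially. y (2 ^ a) < 2 powi (-32) * ln (2 ^ a)"
    using filterlim_iff[THEN iffD1, OF pow, rule_format, OF y_less] by simp
  have big: "\<forall>\<^sub>F a in sequentially. 11 \<le> y (2 ^ a)"
    using filterlim_compose[OF y(2) pow] by (simp add: filterlim_at_top)
  have S_le: "\<forall>\<^sub>F a in sequentially. card (S a) \<le> a"
    using small
  proof eventually_elim
    case (elim a)
    have "2 powi (-32) * ln (2 ^ a) \<le> 1 * ln (2 ^ a :: real)"
      by (intro mult_right_mono) (auto simp: power_int_minus)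
    also have "\<dots> = a * ln 2" by (simp add: ln_realpow)
    also have "\<dots> \<le> real a * 1" using ln_le_minus_one[of "2::real"] by (intro mult_left_mono) auto
    finally show ?case unfolding S_def using elim by (intro card_primes_le_le) simp
  qed
  have S_pos: "\<forall>\<^sub>F a in sequentially. card (S a) > 0"
    using big
  proof eventually_elim
    case (elim a)
    then have "2 \<in> S a" by (simp add: S_def primes_le_def)
    then show ?case by (auto simp: card_gt_0_iff S_def)
  qed
  from eventually_conj[OF count_C eventually_conj[OF count_B eventually_conj[OF small
        eventually_conj[OF big eventually_conj[OF S_pos eventually_conj[OF eventually_exponent_bound
        eventually_ge_at_top[of "K + 1"]]]]]]]
  obtain a0 where a0: "\<And>a. a \<ge> a0 \<Longrightarrow>
      (S (2 * a + k) \<noteq> {} \<longrightarrow> card (C \<inter> {..2 ^ (2 * a) + 1}) \<le> 3 * a * 32 ^ card (S (2 * a + k))) \<and>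
      (S (2 * a + k) \<noteq> {} \<longrightarrow> card (B \<inter> {..2 ^ (2 * a) + 1}) \<le> 3 * a * 32 ^ card (S (2 * a + k))) \<and>
      y (2 ^ a) < 2 powi (-32) * ln (2 ^ a) \<and> 11 \<le> y (2 ^ a) \<and> card (S a) > 0 \<and>
      (\<forall>z. 11 \<le> z \<longrightarrow> z < 2 powi (-32) * ln (2 ^ a) \<longrightarrow>
         (\<exists>m. \<Prod>(primes_le z) ^ m \<le> 2 ^ a \<and> 2 ^ a < \<Prod>(primes_le z) ^ (m + 1) \<and>
            9 * a\<^sup>2 * 2 ^ (30 * card (primes_le z)) < m ^ card (primes_le z))) \<and> K + 1 \<le> a"
    unfolding eventually_sequentially by blast
  obtain a where a: "a \<ge> a0" and slow: "card (S (2 * a + k)) \<le> 3 * card (S a)"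
    using exists_slow_doubling[OF S_le S_pos] by blast
  have "card (S (2 * a + k)) > 0" using a0[of "2 * a + k"] a by simp
  then have "S (2 * a + k) \<noteq> {}" by auto
  with a0[OF a]
  have card_C: "card (C \<inter> {..2 ^ (2 * a) + 1}) \<le> 3 * a * 32 ^ card (S (2 * a + k))"
    and card_B: "card (B \<inter> {..2 ^ (2 * a) + 1}) \<le> 3 * a * 32 ^ card (S (2 * a + k))"
    and aK: "K + 1 \<le> a" by auto
  obtain m where m: "\<Prod>(S a) ^ m \<le> 2 ^ a" "2 ^ a < \<Prod>(S a) ^ (m + 1)"
    "9 * a\<^sup>2 * 2 ^ (30 * card (S a)) < m ^ card (S a)"
    using a0[OF a] unfolding S_def by blast

  define T where "T = {n \<in> {2 ^ a<..(2 ^ a)\<^sup>2}. prime_factors n \<subseteq> S a}"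
  let ?B = "B \<inter> {..2 ^ (2 * a) + 1}" and ?C = "C \<inter> {..2 ^ (2 * a) + 1}"
  have "Suc ` T \<subseteq> (\<lambda>(b, c). b * c) ` (?B \<times> ?C)"
  proof safe
    fix n assume n: "n \<in> T"
    have "a < 2 ^ a" by (rule less_exp)
    moreover have "2 ^ a < n" using n by (simp add: T_def)
    ultimately have nK: "n + 1 \<ge> K" "n \<ge> 2" using aK by linarith+
    have "y (2 ^ a) \<le> y n" using n by (intro mono_onD[OF y(1)]) (auto simp: T_def)
    then have "S a \<subseteq> primes_le (y n)" unfolding S_def by (rule primes_le_mono)
    with n nK have "n \<in> smooth_numbers y" by (auto simp: smooth_numbers_iff T_def)
    with A_iff nK have "n + 1 \<in> B * C" using BC(5) by blast
    then obtain b c where bc: "b \<in> B" "c \<in> C" "n + 1 = b * c" by (auto simp: set_times_def)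
    have "b > 0" "c > 0" using bc BC(1,2) by auto
    then have "b \<le> n + 1" "c \<le> n + 1" unfolding bc by simp_all
    moreover have "n + 1 \<le> 2 ^ (2 * a) + 1"
      using n by (simp add: T_def power_mult[symmetric] mult.commute)
    ultimately have "b \<le> 2 ^ (2 * a) + 1" "c \<le> 2 ^ (2 * a) + 1" by linarith+
    then have "(b, c) \<in> ?B \<times> ?C" using bc by blast
    moreover have "Suc n = b * c" using bc by simp
    ultimately show "Suc n \<in> (\<lambda>(b, c). b * c) ` (?B \<times> ?C)" by force
  qed
  then have "card (Suc ` T) \<le> card ((\<lambda>(b, c). b * c) ` (?B \<times> ?C))" by (intro card_mono) auto
  also have "\<dots> \<le> card (?B \<times> ?C)" by (intro card_image_le) auto
  also have "\<dots> = card ?B * card ?C" by (rule card_cartesian_product)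
  also have "\<dots> \<le> (3 * a * 32 ^ card (S (2 * a + k))) * (3 * a * 32 ^ card (S (2 * a + k)))"
    using card_B card_C by (rule mult_le_mono)
  also have "\<dots> = 9 * a\<^sup>2 * 2 ^ (10 * card (S (2 * a + k)))"
  proof -
    have "(32::nat) ^ r * 32 ^ r = 2 ^ (10 * r)" for r
      by (simp add: power_mult power_mult_distrib[symmetric])
    then show ?thesis by (simp add: power2_eq_square)
  qed
  also have "\<dots> \<le> 9 * a\<^sup>2 * 2 ^ (30 * card (S a))"
    using slow by (intro mult_le_mono2 power_increasing) auto
  also have "\<dots> < m ^ card (S a)" by (rule m(3))
  also have "\<dots> \<le> card T"
    unfolding T_def using m(1,2) by (intro power_card_le_card_smooth) (auto simp: S_def prime_primes_le)
  also have "\<dots> = card (Suc ` T)" by (simp add: card_image)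
  finally show False by simp
qed

theorem theorem1p2:
  fixes y :: "nat \<Rightarrow> real"
  assumes "\<And>n. n \<ge> 1 \<Longrightarrow> y n > 0"
    and "mono_on {1..} y"
    and "filterlim y at_top sequentially"
    and "\<forall>\<^sub>F n in sequentially. y n < 2 powi (-32) * ln (real n)"
  shows "totally_m_primitive (smooth_numbers y + {1})"
proof -
  let ?G = "smooth_numbers y + {1}"
  have G: "?G = Suc ` smooth_numbers y" by (auto simp: set_plus_def)
  have "infinite ?G"
    unfolding G using infinite_smooth_numbers[OF assms(3)] by (simp add: finite_image_iff)
  moreover have "?G \<subseteq> {1..}" unfolding G by auto
  moreover have "m_primitive A" if A: "A \<subseteq> {1..}" "asymp_eq_sets A ?G" for A
  proof -
    obtain K where K: "A \<inter> {K..} = ?G \<inter> {K..}" using A(2) unfolding asymp_eq_sets_def by blast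
    have "finite A \<Longrightarrow> finite (?G \<inter> {K..} \<union> {..<K})" unfolding K[symmetric] by simp
    moreover have "?G \<subseteq> ?G \<inter> {K..} \<union> {..<K}" by auto
    ultimately have "infinite A" using \<open>infinite ?G\<close> finite_subset by blast
    then show ?thesis
      unfolding m_primitive_def
      using A not_m_reducible_asymp_eq_shifted_smooth[OF assms(2-4)] by blast
  qed
  ultimately show ?thesis unfolding totally_m_primitive_def by blast
qed

end
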